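(* Let $(\kappa,\rho)\in W$ and $(a,b,m,n)\in\mathrm{ABMN}(\kappa,\rho)$. (1) For every $i\in\mathbb{Z}$, $m_{i+1}>m_i$ and $n_i>n_{i+1}$. (2) The boundary values satisfy $\infty>m_\infty>m_{-\infty}>-\infty$ and $\infty>n_{-\infty}>n_\infty>-\infty$.
   Context: $W=\{(\kappa,\rho)\in(0,1]\times(0,\infty):\rho^2\kappa\le1\}$. $\mathrm{ABMN}(\kappa,\rho)$ is the set of sequences $(a_i,b_i,m_i,n_i)_{i\in\mathbb{Z}}$ with values in $(0,\infty)^2\times\mathbb{R}^2$ satisfying, for every $i\in\mathbb{Z}$, $$2(a_i^\rho+b_i^\rho)(m_i+a_i)=\big(a_i^\rho(1-\kappa)+b_i^\rho(1+\kappa)\big)m_{i-1}+\big(a_i^\rho(1+\kappa)+b_i^\rho(1-\kappa)\big)m_{i+1},$$ $$2(a_i^\rho+b_i^\rho)(n_i+b_i)=\big(a_i^\rho(1-\kappa)+b_i^\rho(1+\kappa)\big)n_{i-1}+\big(a_i^\rho(1+\kappa)+b_i^\rho(1-\kappa)\big)n_{i+1},$$ $$(a_i^\rho+b_i^\rho)^2=\rho\kappa\,a_i^{\rho-1}b_i^\rho\,(m_{i+1}-m_{i-1}),\qquad (a_i^\rho+b_i^\rho)^2=\rho\kappa\,a_i^{\rho}b_i^{\rho-1}\,(n_{i-1}-n_{i+1}).$$ The boundary values are the limits $m_{\pm\infty}=\lim_{k\to\infty}m_{\pm k}$ and $n_{\pm\infty}=\lim_{k\to\infty}n_{\pm k}$,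 which exist in $[-\infty,\infty]$ in view of the monotonicity in (1). *)

theory Defs
  imports "HOL-Library.Extended_Real"
begin

definition W :: "(real \<times> real) set" where
  "W = {(\<kappa>, \<rho>). 0 < \<kappa> \<and> \<kappa> \<le> 1 \<and> 0 < \<rho> \<and> \<rho>\<^sup>2 * \<kappa> \<le> 1}"

definition ABMN ::
  "real \<Rightarrow> real \<Rightarrow> ((int \<Rightarrow> real) \<times> (int \<Rightarrow> real) \<times> (int \<Rightarrow> real) \<times> (int \<Rightarrow> real)) set" where
  "ABMN \<kappa> \<rho> = {(a, b, m, n). \<forall>i.
     0 < a i \<and> 0 < b i \<and>
     2 * (a i powr \<rho> + b i powr \<rho>) * (m i + a i)
       = (a i powr \<rho> * (1 - \<kappa>) + b i powr \<rho> * (1 + \<kappa>)) * m (i - 1)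
         + (a i powr \<rho> * (1 + \<kappa>) + b i powr \<rho> * (1 - \<kappa>)) * m (i + 1) \<and>
     2 * (a i powr \<rho> + b i powr \<rho>) * (n i + b i)
       = (a i powr \<rho> * (1 - \<kappa>) + b i powr \<rho> * (1 + \<kappa>)) * n (i - 1)
         + (a i powr \<rho> * (1 + \<kappa>) + b i powr \<rho> * (1 - \<kappa>)) * n (i + 1) \<and>
     (a i powr \<rho> + b i powr \<rho>)\<^sup>2
       = \<rho> * \<kappa> * a i powr (\<rho> - 1) * b i powr \<rho> * (m (i + 1) - m (i - 1)) \<and>
     (a i powr \<rho> + b i powr \<rho>)\<^sup>2
       = \<rho> * \<kappa> * a i powr \<rho> * b i powr (\<rho> - 1) * (n (i - 1) - n (i + 1))}"

(* The boundary values are limits in the extended reals. Since lim is unspecified on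
   divergent sequences, existence of the limit has to be asserted alongside its use. *)

definition right_boundary :: "(int \<Rightarrow> real) \<Rightarrow> ereal" where
  "right_boundary f = lim (\<lambda>k::nat. ereal (f (int k)))"

definition left_boundary :: "(int \<Rightarrow> real) \<Rightarrow> ereal" where
  "left_boundary f = lim (\<lambda>k::nat. ereal (f (- int k)))"

definition has_boundary_values :: "(int \<Rightarrow> real) \<Rightarrow> bool" where
  "has_boundary_values f \<longleftrightarrow>
     convergent (\<lambda>k::nat. ereal (f (int k))) \<and> convergent (\<lambda>k::nat. ereal (f (- int k)))"

end

(* Write M_i = m_{i+1} - m_{i-1} and N_i = n_{i-1} - n_{i+1}. The last two defining equations give
   a_i = t_i M_i and b_i = t_i N_i for a common t_i > 0, and the first two then split M_i and N_i
   into consecutive increments with explicit weights. This yields monotonicity at once.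
   Comparing the ratio of the increment of m to that of n over the same edge, computed from either
   endpoint of the edge, gives a_{i+1} / b_{i+1} >= (1 + 2 t_i) a_i / b_i, which forces a_i / b_i to
   diverge at +infinity. There the increments of m and n decay geometrically, so the boundary values
   at +infinity are finite. The reflection i -> -i, exchanging (a,m) with (b,n), handles -infinity. *)

theory Submission
  imports Defs
begin

section \<open>Normalised weights and the splitting of wide increments\<close>

locale abmn =
  fixes \<kappa> \<rho> :: real and a b m n :: "int \<Rightarrow> real"
  assumes \<kappa>_pos: "0 < \<kappa>" and \<kappa>_le_1: "\<kappa> \<le> 1" and \<rho>_pos: "0 < \<rho>"
    and mem: "(a, b, m, n) \<in> ABMN \<kappa> \<rho>"
begin

definition v :: "int \<Rightarrow> real" where
  "v i = b i powr \<rho> / (a i powr \<rho> + b i powr \<rho>)"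

definition t :: "int \<Rightarrow> real" where
  "t i = \<rho> * \<kappa> * (1 - v i) * v i"

text \<open>The coefficient of index \<open>i - 1\<close> once the two averaging equations are
  divided by \<open>2 * (a i powr \<rho> + b i powr \<rho>)\<close>; index \<open>i + 1\<close> then
  gets \<open>1 - left_weight i\<close>.\<close>

definition left_weight :: "int \<Rightarrow> real" where
  "left_weight i = (1 - \<kappa>) / 2 + \<kappa> * v i"

lemma a_pos: "0 < a i" and b_pos: "0 < b i"
  using mem by (auto simp: ABMN_def)

lemma v_pos: "0 < v i" and v_less_1: "v i < 1"
  using a_pos[of i] b_pos[of i] by (auto simp: v_def add_pos_pos)

lemma t_pos: "0 < t i"
  using v_pos[of i] v_less_1[of i] \<kappa>_pos \<rho>_pos by (simp add: t_def)

lemma left_weight_pos: "0 < left_weight i" and left_weight_less_1: "left_weight i < 1"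
proof -
  show "0 < left_weight i"
    using v_pos[of i] \<kappa>_pos \<kappa>_le_1 by (simp add: left_weight_def add_nonneg_pos)
  have "\<kappa> * v i < \<kappa> * 1"
    using v_less_1[of i] \<kappa>_pos by (intro mult_strict_left_mono)
  then show "left_weight i < 1"
    using \<kappa>_le_1 by (simp add: left_weight_def field_simps)
qed

text \<open>Because \<open>a i powr (\<rho> - 1) = A / a i\<close>, and likewise for
  \<open>b\<close>, the last two equations can be solved for \<open>a i\<close> and
  \<open>b i\<close> with the same factor, which equals \<open>t i\<close> since
  \<open>v i = B / (A + B)\<close>.\<close>

lemma a_eq: "a i = t i * (m (i + 1) - m (i - 1))"
  and b_eq: "b i = t i * (n (i - 1) - n (i + 1))"
proof -
  define A B where "A = a i powr \<rho>" and "B = b i powr \<rho>"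
  have pos: "0 < A" "0 < B"
    using a_pos[of i] b_pos[of i] by (auto simp: A_def B_def)
  have "a i powr (\<rho> - 1) = A / a i" "b i powr (\<rho> - 1) = B / b i"
    using a_pos[of i] b_pos[of i] by (auto simp: A_def B_def powr_diff)
  moreover have "(A + B)\<^sup>2 = \<rho> * \<kappa> * a i powr (\<rho> - 1) * B * (m (i + 1) - m (i - 1))"
    "(A + B)\<^sup>2 = \<rho> * \<kappa> * A * b i powr (\<rho> - 1) * (n (i - 1) - n (i + 1))"
    using mem unfolding ABMN_def A_def B_def by blast+
  ultimately have eqs: "(A + B)\<^sup>2 = \<rho> * \<kappa> * (A / a i) * B * (m (i + 1) - m (i - 1))"
    "(A + B)\<^sup>2 = \<rho> * \<kappa> * A * (B / b i) * (n (i - 1) - n (i + 1))"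
    by (simp_all only:)
  have "a i * (A + B)\<^sup>2 = \<rho> * \<kappa> * A * B * (m (i + 1) - m (i - 1))"
    unfolding eqs(1) using a_pos[of i] by simp
  moreover have "b i * (A + B)\<^sup>2 = \<rho> * \<kappa> * A * B * (n (i - 1) - n (i + 1))"
    unfolding eqs(2) using b_pos[of i] by simp
  ultimately have "a i = \<rho> * \<kappa> * A * B / (A + B)\<^sup>2 * (m (i + 1) - m (i - 1))"
    "b i = \<rho> * \<kappa> * A * B / (A + B)\<^sup>2 * (n (i - 1) - n (i + 1))"
    using pos by (simp_all add: nonzero_eq_divide_eq)
  moreover have "1 - v i = A / (A + B)"
    using pos by (simp add: v_def flip: A_def B_def) (simp add: field_simps)
  then have "t i = \<rho> * \<kappa> * A * B / (A + B)\<^sup>2"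
    by (simp add: t_def v_def A_def B_def power2_eq_square)
  ultimately show "a i = t i * (m (i + 1) - m (i - 1))"
    "b i = t i * (n (i - 1) - n (i + 1))"
    by simp_all
qed

lemma m_wide_increment_pos: "0 < m (i + 1) - m (i - 1)"
  and n_wide_increment_pos: "0 < n (i - 1) - n (i + 1)"
  using a_eq[of i] b_eq[of i] a_pos[of i] b_pos[of i] t_pos[of i]
  by (metis zero_less_mult_pos)+

lemma m_mean: "m i + a i = left_weight i * m (i - 1) + (1 - left_weight i) * m (i + 1)"
  and n_mean: "n i + b i = left_weight i * n (i - 1) + (1 - left_weight i) * n (i + 1)"
proof -
  define A B where "A = a i powr \<rho>" and "B = b i powr \<rho>"
  have pos: "0 < A" "0 < B"
    using a_pos[of i] b_pos[of i] by (auto simp: A_def B_def)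
  have "left_weight i = (1 - \<kappa>) / 2 + \<kappa> * (B / (A + B))"
    by (simp add: left_weight_def v_def A_def B_def)
  then have l: "2 * (A + B) * left_weight i = A * (1 - \<kappa>) + B * (1 + \<kappa>)"
    "2 * (A + B) * (1 - left_weight i) = A * (1 + \<kappa>) + B * (1 - \<kappa>)"
    using pos by (simp_all add: field_simps)
  have "2 * (A + B) * (m i + a i)
      = (A * (1 - \<kappa>) + B * (1 + \<kappa>)) * m (i - 1) + (A * (1 + \<kappa>) + B * (1 - \<kappa>)) * m (i + 1)"
    "2 * (A + B) * (n i + b i)
      = (A * (1 - \<kappa>) + B * (1 + \<kappa>)) * n (i - 1) + (A * (1 + \<kappa>) + B * (1 - \<kappa>)) * n (i + 1)"
    using mem unfolding ABMN_def A_def B_def by blast+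
  then have "2 * (A + B) * (m i + a i)
      = 2 * (A + B) * (left_weight i * m (i - 1) + (1 - left_weight i) * m (i + 1))"
    "2 * (A + B) * (n i + b i)
      = 2 * (A + B) * (left_weight i * n (i - 1) + (1 - left_weight i) * n (i + 1))"
    unfolding l[symmetric] by (simp_all only: distrib_left mult.assoc)
  then show "m i + a i = left_weight i * m (i - 1) + (1 - left_weight i) * m (i + 1)"
    "n i + b i = left_weight i * n (i - 1) + (1 - left_weight i) * n (i + 1)"
    using pos by simp_all
qed

text \<open>Eliminating \<open>a i\<close> from the mean equation turns the two edges at
  \<open>i\<close> into shares of the wide increment that sum to 1. For \<open>n\<close> the sign of
  \<open>t\<close> flips because its differences are taken downwards.\<close>

lemma m_right_increment: "m (i + 1) - m i = (left_weight i + t i) * (m (i + 1) - m (i - 1))"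
  and m_left_increment: "m i - m (i - 1) = (1 - left_weight i - t i) * (m (i + 1) - m (i - 1))"
  using m_mean[of i] a_eq[of i] by (simp_all add: algebra_simps)

lemma n_right_increment: "n i - n (i + 1) = (left_weight i - t i) * (n (i - 1) - n (i + 1))"
  and n_left_increment: "n (i - 1) - n i = (1 - left_weight i + t i) * (n (i - 1) - n (i + 1))"
  using n_mean[of i] b_eq[of i] by (simp_all add: algebra_simps)

section \<open>Strict monotonicity\<close>

lemma m_less: "m i < m (i + 1)"
proof -
  have "0 < (left_weight i + t i) * (m (i + 1) - m (i - 1))"
    using left_weight_pos t_pos m_wide_increment_pos by (intro mult_pos_pos add_pos_pos)
  then show ?thesis
    using m_right_increment[of i] by linarith
qed

text \<open>Each edge is read from the endpoint where \<open>t\<close> enters with a plus sign, so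
  that its share is visibly positive; for \<open>n\<close> this is the right endpoint.\<close>

lemma n_greater: "n (i + 1) < n i"
proof -
  have "0 < (1 - left_weight (i + 1) + t (i + 1)) * (n (i + 1 - 1) - n (i + 1 + 1))"
    using left_weight_less_1[of "i + 1"] t_pos n_wide_increment_pos
    by (intro mult_pos_pos add_pos_pos) (simp_all only: diff_gt_0_iff_gt)
  then show ?thesis
    using n_left_increment[of "i + 1"] by simp
qed

text \<open>Monotonicity makes both the edge and the wide increment of \<open>n\<close> positive,
  hence also the share relating them.\<close>

lemma t_less_left_weight: "t i < left_weight i"
  using n_right_increment[of i] n_greater[of i] n_wide_increment_pos[of i]
  by (metis diff_gt_0_iff_gt zero_less_mult_pos2)

section \<open>Growth of the ratio a / b\<close>

lemma ratio_eq: "a i / b i = (m (i + 1) - m (i - 1)) / (n (i - 1) - n (i + 1))"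
  using a_eq[of i] b_eq[of i] t_pos[of i] by simp

text \<open>Seen from \<open>i\<close>, the edge ratio \<open>?x / ?y\<close> is
  \<open>a i / b i\<close> times a factor above 1; seen from \<open>i + 1\<close>, it is at most
  \<open>a (i + 1) / b (i + 1)\<close>, since there \<open>t\<close> lowers the share of
  \<open>m\<close> and raises that of \<open>n\<close>.\<close>

lemma ratio_step: "(1 + 2 * t i) * (a i / b i) \<le> a (i + 1) / b (i + 1)"
proof -
  let ?x = "m (i + 1) - m i" and ?y = "n i - n (i + 1)"
  have y: "0 < ?y"
    using n_greater[of i] by simp
  \<comment> \<open>The right side exceeds \<open>left_weight i - t i\<close> by
    \<open>2 * t i\<close>, and \<open>left_weight i - t i\<close> is below 1.\<close>
  have "(1 + 2 * t i) * (left_weight i - t i) \<le> left_weight i + t i"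
  proof -
    have "t i * (left_weight i - t i) \<le> t i * 1"
      using t_pos[of i] left_weight_less_1[of i] by (intro mult_left_mono) simp_all
    then show ?thesis
      by (simp add: algebra_simps)
  qed
  then have "1 + 2 * t i \<le> (left_weight i + t i) / (left_weight i - t i)"
    using t_less_left_weight[of i] by (simp add: pos_le_divide_eq)
  then have "(1 + 2 * t i) * (a i / b i)
      \<le> (left_weight i + t i) / (left_weight i - t i) * (a i / b i)"
    using a_pos[of i] b_pos[of i] by (intro mult_right_mono) simp_all
  also have "\<dots> = ?x / ?y"
    by (simp add: ratio_eq m_right_increment[of i] n_right_increment[of i])
  also have "\<dots> \<le> a (i + 1) / b (i + 1)"
  proof -
    define j where "j = i + 1"
    define M N where "M = m (j + 1) - m (j - 1)" and "N = n (j - 1) - n (j + 1)"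
    have MN: "0 < M" "0 < N"
      using m_wide_increment_pos[of j] n_wide_increment_pos[of j] by (auto simp: M_def N_def)
    have xy: "?x = (1 - left_weight j - t j) * M" "?y = (1 - left_weight j + t j) * N"
      using m_left_increment[of j] n_left_increment[of j] by (simp_all add: M_def N_def j_def)
    \<comment> \<open>The two sides differ by \<open>2 * t j * M * N\<close>.\<close>
    have "?x * N \<le> M * ?y"
      using mult_pos_pos[OF t_pos[of j] mult_pos_pos[OF MN]] unfolding xy
      by (simp add: algebra_simps)
    then have "?x / ?y \<le> M / N"
      using MN y by (simp add: divide_le_eq pos_le_divide_eq mult.commute)
    then show ?thesis
      using ratio_eq[of j] by (simp add: M_def N_def j_def)
  qed
  finally show ?thesis .
qed

section \<open>Decay of \<open>v\<close> towards plus infinity\<close>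

lemma v_eq: "v i = 1 / (1 + (a i / b i) powr \<rho>)"
  using a_pos[of i] b_pos[of i] by (simp add: v_def powr_divide field_simps)

lemma v_antimono:
  assumes "i \<le> j"
  shows "v j \<le> v i"
proof -
  have "a i / b i \<le> a j / b j"
    using assms
  proof (induction j rule: int_ge_induct)
    case (step j)
    have "1 * (a j / b j) \<le> (1 + 2 * t j) * (a j / b j)"
      using a_pos[of j] b_pos[of j] t_pos[of j] by (intro mult_right_mono) simp_all
    with step ratio_step[of j] show ?case
      by linarith
  qed simp
  then have "(a i / b i) powr \<rho> \<le> (a j / b j) powr \<rho>"
    using a_pos[of i] b_pos[of i] \<rho>_pos by (intro powr_mono2) simp_all
  then show ?thesis
    unfolding v_eq using a_pos[of i] b_pos[of i]
    by (intro divide_left_mono) (auto intro!: mult_pos_pos add_pos_nonneg)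
qed

text \<open>If \<open>v\<close> stayed above \<epsilon>, then \<open>t\<close> would be bounded
  below, so a / b would grow geometrically and push \<open>v\<close> below \<epsilon> after
  all.\<close>

lemma v_eventually_small:
  assumes "0 < \<epsilon>"
  obtains K :: nat where "\<And>i. int K \<le> i \<Longrightarrow> v i < \<epsilon>"
proof -
  have "\<exists>K::nat. v (int K) < \<epsilon>"
  proof (rule ccontr)
    assume "\<not> ?thesis"
    then have ge: "\<epsilon> \<le> v (int k)" for k
      by (simp add: not_less)
    \<comment> \<open>Along the nonnegative indices \<open>v\<close> is at least \<epsilon> by
      assumption, and \<open>1 - v\<close> is at least \<open>1 - v 0\<close> by
      antitonicity.\<close>
    define \<delta> where "\<delta> = 2 * (\<rho> * \<kappa> * (1 - v 0) * \<epsilon>)"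
    have \<delta>: "0 < \<delta>"
      using assms \<kappa>_pos \<rho>_pos v_less_1[of 0] by (simp add: \<delta>_def)
    have \<delta>_le: "\<delta> \<le> 2 * t (int k)" for k
      unfolding \<delta>_def t_def using assms ge[of k] v_antimono[of 0 "int k"] v_less_1 \<kappa>_pos \<rho>_pos
      by (intro mult_mono mult_left_mono mult_nonneg_nonneg) (auto simp: less_imp_le)
    have growth: "(1 + \<delta>) ^ k * (a 0 / b 0) \<le> a (int k) / b (int k)" for k
    proof (induction k)
      case (Suc k)
      have "(1 + \<delta>) ^ Suc k * (a 0 / b 0) = (1 + \<delta>) * ((1 + \<delta>) ^ k * (a 0 / b 0))"
        by simp
      also have "\<dots> \<le> (1 + 2 * t (int k)) * (a (int k) / b (int k))"
        using Suc \<delta> \<delta>_le[of k] t_pos[of "int k"] a_pos[of 0] b_pos[of 0]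
        by (intro mult_mono) simp_all
      also have "\<dots> \<le> a (int (Suc k)) / b (int (Suc k))"
        using ratio_step[of "int k"] by (simp add: add.commute)
      finally show ?case .
    qed simp
    \<comment> \<open>Chosen so that \<open>C powr \<rho> = 1 / \<epsilon>\<close>: a ratio above
      \<open>C\<close> contradicts \<open>v \<ge> \<epsilon>\<close> through
      \<open>v_eq\<close>.\<close>
    define C where "C = (1 / \<epsilon>) powr (1 / \<rho>)"
    obtain k where k: "C / (a 0 / b 0) < (1 + \<delta>) ^ k"
      using real_arch_pow[of "1 + \<delta>"] \<delta> by auto
    have "C < (1 + \<delta>) ^ k * (a 0 / b 0)"
      using k a_pos[of 0] b_pos[of 0] by (simp only: pos_divide_less_eq divide_pos_pos)
    then have "C < a (int k) / b (int k)"
      using growth[of k] by linarith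
    then have "C powr \<rho> < (a (int k) / b (int k)) powr \<rho>"
      using \<rho>_pos by (intro powr_less_mono2) (simp_all add: C_def)
    moreover have "C powr \<rho> = 1 / \<epsilon>"
      using \<rho>_pos assms by (simp add: C_def powr_powr)
    ultimately have "1 / \<epsilon> < 1 + (a (int k) / b (int k)) powr \<rho>"
      by simp
    then have "1 / (1 + (a (int k) / b (int k)) powr \<rho>) < 1 / (1 / \<epsilon>)"
      using assms by (intro divide_strict_left_mono) (auto intro!: divide_pos_pos add_pos_nonneg)
    then show False
      using ge[of k] by (simp add: v_eq)
  qed
  then obtain K :: nat where "v (int K) < \<epsilon>" ..
  then show ?thesis
    using v_antimono by (intro that[of K]) (meson le_less_trans)
qed

section \<open>Geometric decay of increments and convergence at both ends\<close>

lemma right_increments_eventually_small: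
  obtains K :: nat where "\<And>i. int K \<le> i \<Longrightarrow> left_weight i + t i \<le> 1 / 2 - \<kappa> / 4"
proof -
  \<comment> \<open>As \<open>v\<close> tends to 0, the share tends to
    \<open>(1 - \<kappa>) / 2\<close>. The error is at most
    \<open>\<kappa> * (1 + \<rho>) * v i\<close>, so this threshold spends only half of the gap
    \<open>\<kappa> / 2\<close> below 1/2.\<close>
  obtain K :: nat where K: "\<And>i. int K \<le> i \<Longrightarrow> v i < 1 / (4 * (1 + \<rho>))"
    using v_eventually_small[of "1 / (4 * (1 + \<rho>))"] \<rho>_pos by auto
  have "left_weight i + t i \<le> 1 / 2 - \<kappa> / 4" if "int K \<le> i" for i
  proof -
    have "(1 - v i) * v i \<le> 1 * v i"
      using v_pos[of i] by (intro mult_right_mono) simp_all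
    then have "\<rho> * \<kappa> * ((1 - v i) * v i) \<le> \<rho> * \<kappa> * (1 * v i)"
      using \<rho>_pos \<kappa>_pos by (intro mult_left_mono) simp_all
    then have "t i \<le> \<rho> * \<kappa> * v i"
      by (simp add: t_def mult.assoc)
    then have "left_weight i + t i \<le> (1 - \<kappa>) / 2 + \<kappa> * ((1 + \<rho>) * v i)"
      by (simp add: left_weight_def algebra_simps)
    also have "(1 + \<rho>) * v i \<le> 1 / 4"
      using K[OF that] \<rho>_pos by (simp add: field_simps)
    then have "(1 - \<kappa>) / 2 + \<kappa> * ((1 + \<rho>) * v i) \<le> (1 - \<kappa>) / 2 + \<kappa> * (1 / 4)"
      using \<kappa>_pos by (intro add_left_mono mult_left_mono) simp_all
    finally show ?thesis
      by (simp add: field_simps)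
  qed
  then show ?thesis
    by (rule that)
qed

text \<open>A share of at most \<open>c = 1 / 2 - \<kappa> / 4\<close> bounds the quotient of
  consecutive increments by \<open>c / (1 - c) = (2 - \<kappa>) / (2 + \<kappa>)\<close>, which is
  below 1, so the telescoping series converges.\<close>

lemma convergent_if_increments_contract:
  fixes f :: "int \<Rightarrow> real"
  assumes "\<And>i. int K \<le> i \<Longrightarrow>
    \<bar>f (i + 1) - f i\<bar> \<le> (1 / 2 - \<kappa> / 4) * (\<bar>f (i + 1) - f i\<bar> + \<bar>f i - f (i - 1)\<bar>)"
  shows "convergent (\<lambda>k. f (int k))"
proof -
  define g where "g k = f (int (Suc k)) - f (int k)" for k
  have "norm (g (Suc k)) \<le> (2 - \<kappa>) / (2 + \<kappa>) * norm (g k)" if "K \<le> k" for k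
    using assms[of "int (Suc k)"] that \<kappa>_pos
    by (simp add: g_def add.commute add.left_commute field_simps)
  then have "summable g"
    using \<kappa>_pos by (intro summable_ratio_test[of "(2 - \<kappa>) / (2 + \<kappa>)" K]) auto
  moreover have "(\<Sum>k<l. g k) = f (int l) - f 0" for l
    unfolding g_def using sum_lessThan_telescope[of "\<lambda>k. f (int k)" l] by simp
  ultimately have "convergent (\<lambda>l. (f (int l) - f 0) + f 0)"
    by (intro convergent_add) (simp_all add: summable_iff_convergent convergent_const)
  then show ?thesis
    by simp
qed

lemma convergent_right: "convergent (\<lambda>k. m (int k))" "convergent (\<lambda>k. n (int k))"
proof -
  obtain K :: nat where K: "\<And>i. int K \<le> i \<Longrightarrow> left_weight i + t i \<le> 1 / 2 - \<kappa> / 4"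
    using right_increments_eventually_small by blast
  show "convergent (\<lambda>k. m (int k))"
  proof (rule convergent_if_increments_contract)
    fix i assume "int K \<le> i"
    then have "(left_weight i + t i) * (m (i + 1) - m (i - 1))
        \<le> (1 / 2 - \<kappa> / 4) * (m (i + 1) - m (i - 1))"
      using m_wide_increment_pos[of i] K[of i] by (intro mult_right_mono) simp_all
    then show "\<bar>m (i + 1) - m i\<bar>
        \<le> (1 / 2 - \<kappa> / 4) * (\<bar>m (i + 1) - m i\<bar> + \<bar>m i - m (i - 1)\<bar>)"
      using m_right_increment[of i, symmetric] m_less[of i] m_less[of "i - 1"] by simp
  qed
  \<comment> \<open>The same \<open>K\<close> serves, as the share
    \<open>left_weight i - t i\<close> is smaller still.\<close>
  show "convergent (\<lambda>k. n (int k))"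
  proof (rule convergent_if_increments_contract)
    fix i assume "int K \<le> i"
    then have "(left_weight i - t i) * (n (i - 1) - n (i + 1))
        \<le> (1 / 2 - \<kappa> / 4) * (n (i - 1) - n (i + 1))"
      using n_wide_increment_pos[of i] K[of i] t_pos[of i] by (intro mult_right_mono) simp_all
    then show "\<bar>n (i + 1) - n i\<bar>
        \<le> (1 / 2 - \<kappa> / 4) * (\<bar>n (i + 1) - n i\<bar> + \<bar>n i - n (i - 1)\<bar>)"
      using n_right_increment[of i, symmetric] n_greater[of i] n_greater[of "i - 1"] by simp
  qed
qed

text \<open>Reflection swaps the neighbours \<open>i - 1\<close> and \<open>i + 1\<close>, and
  exchanging \<open>a\<close> with \<open>b\<close> swaps their coefficients back. The equations for
  \<open>m\<close> and \<open>n\<close> at \<open>- i\<close> thus trade places.\<close>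

lemma reflect: "abmn \<kappa> \<rho> (\<lambda>i. b (- i)) (\<lambda>i. a (- i)) (\<lambda>i. n (- i)) (\<lambda>i. m (- i))"
proof (unfold_locales, fact \<kappa>_pos, fact \<kappa>_le_1, fact \<rho>_pos)
  have idx: "- (i + 1) = - i - 1" "- (i - 1) = - i + 1" for i :: int
    by simp_all
  have all_uminus: "(\<forall>i. P (- i)) \<longleftrightarrow> (\<forall>i. P i)" for P :: "int \<Rightarrow> bool"
    by (metis minus_minus)
  show "(\<lambda>i. b (- i), \<lambda>i. a (- i), \<lambda>i. n (- i), \<lambda>i. m (- i)) \<in> ABMN \<kappa> \<rho>"
    using mem unfolding ABMN_def mem_Collect_eq prod.case idx
    by (subst (asm) all_uminus[symmetric]) (simp (no_asm_use) only: ac_simps)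
qed

lemma convergent_left: "convergent (\<lambda>k. m (- int k))" "convergent (\<lambda>k. n (- int k))"
  using abmn.convergent_right[OF reflect] by simp_all

end

section \<open>Boundary values in the extended reals\<close>

lemma boundary_values_strict_mono:
  fixes f :: "int \<Rightarrow> real"
  assumes less: "\<And>i. f i < f (i + 1)"
    and conv: "convergent (\<lambda>k. f (int k))" "convergent (\<lambda>k. f (- int k))"
  shows "has_boundary_values f" "right_boundary f < \<infinity>"
    "left_boundary f < right_boundary f" "- \<infinity> < left_boundary f"
proof -
  obtain R L where R: "(\<lambda>k. f (int k)) \<longlonglongrightarrow> R" and L: "(\<lambda>k. f (- int k)) \<longlonglongrightarrow> L"
    using conv by (auto simp: convergent_def)
  have "incseq (\<lambda>k. f (int k))"
    using less[of "int k" for k] by (intro incseq_SucI) (simp add: add.commute less_imp_le)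
  from incseq_le[OF this R, of 1] have "f 1 \<le> R"
    by simp
  have "decseq (\<lambda>k. f (- int k))"
    using less[of "- int (Suc k)" for k] by (intro decseq_SucI) (simp add: less_imp_le)
  from decseq_ge[OF this L, of 0] have "L \<le> f 0"
    by simp
  have ereal_lims: "(\<lambda>k. ereal (f (int k))) \<longlonglongrightarrow> ereal R" "(\<lambda>k. ereal (f (- int k))) \<longlonglongrightarrow> ereal L"
    using R L by simp_all
  then have eqs: "right_boundary f = ereal R" "left_boundary f = ereal L"
    by (simp_all add: right_boundary_def left_boundary_def limI)
  show "has_boundary_values f"
    using ereal_lims by (auto simp: has_boundary_values_def convergent_def)
  show "right_boundary f < \<infinity>" "- \<infinity> < left_boundary f"
    by (simp_all add: eqs)
  \<comment> \<open>Limits preserve only weak inequalities; strictness comes from the single step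
    \<open>f 0 < f 1\<close> between them.\<close>
  show "left_boundary f < right_boundary f"
    using \<open>f 1 \<le> R\<close> \<open>L \<le> f 0\<close> less[of 0] by (simp add: eqs)
qed

lemma boundary_values_reflect:
  "right_boundary (\<lambda>i. f (- i)) = left_boundary f"
  "left_boundary (\<lambda>i. f (- i)) = right_boundary f"
  "has_boundary_values (\<lambda>i. f (- i)) \<longleftrightarrow> has_boundary_values f"
  by (auto simp: right_boundary_def left_boundary_def has_boundary_values_def)

theorem theorem1p4:
  fixes \<kappa> \<rho> :: real and a b m n :: "int \<Rightarrow> real"
  assumes "(\<kappa>, \<rho>) \<in> W"
    and "(a, b, m, n) \<in> ABMN \<kappa> \<rho>"
  shows "(\<forall>i. m (i + 1) > m i \<and> n i > n (i + 1)) \<and>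
         has_boundary_values m \<and> has_boundary_values n \<and>
         \<infinity> > right_boundary m \<and> right_boundary m > left_boundary m \<and> left_boundary m > - \<infinity> \<and>
         \<infinity> > left_boundary n \<and> left_boundary n > right_boundary n \<and> right_boundary n > - \<infinity>"
proof -
  interpret abmn \<kappa> \<rho> a b m n
    using assms by unfold_locales (auto simp: W_def)
  interpret reflected: abmn \<kappa> \<rho> "\<lambda>i. b (- i)" "\<lambda>i. a (- i)" "\<lambda>i. n (- i)" "\<lambda>i. m (- i)"
    by (rule reflect)
  note m_bounds = boundary_values_strict_mono[OF m_less convergent_right(1) convergent_left(1)]
  \<comment> \<open>Since \<open>n\<close> decreases, its reflection is increasing and plays the
    role of \<open>m\<close> in the reflected system; unfolding exchanges the two ends back.\<close>
  note n_bounds = boundary_values_strict_mono[OF reflected.m_less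
      reflected.convergent_right(1) reflected.convergent_left(1), unfolded boundary_values_reflect]
  show ?thesis
    using m_less n_greater m_bounds n_bounds by blast
qed

end
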